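(* Let $k$ be a positive integer and let $\mathcal{A}$ be a monotone family of subsets of $[n]$ with all minterms of size at most $k$. Then the function $p \mapsto \frac{\mu(\mathcal{A},p)}{p^k}$ is monotone decreasing (in the weak sense, i.e. non-increasing). Consequently, for $\mathcal{A}$ non-trivial and $0<\epsilon<1$, $$\delta_\epsilon(\mathcal{A})\ge 1-(2\epsilon)^{1/k}.$$
   Context: Let $[n]=\{0,1,\ldots,n\}$. For $p\in[0,1]$, $[n]_p$ denotes a random subset of $[n]$ in which each element is included independently with probability $p$. For a family $\mathcal{A}$ of subsets of $[n]$, $\mu(\mathcal{A},p)=\Pr([n]_p\in\mathcal{A})$. A family $\mathcal{A}$ is monotone if $A\in\mathcal{A}$ and $A\subset B\subseteq [n]$ imply $B\in\mathcal{A}$. A minterm of $\mathcal{A}$ is a member of $\mathcal{A}$ that is minimal with respect to inclusion. A monotone family is non-trivial if it is neither empty nor the whole power set of $[n]$. For a non-trivial monotone family $\mathcal{A}$ and $x\in[0,1]$, $p_x$ is the unique number in $[0,1]$ with $\mu(\mathcal{A},p_x)=x$. For $0<\epsilon<1$ define $\delta_\epsilon(\mathcal{A})=\frac{p_{1/2}-p_\epsilon}{p_{1/2}}$.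
   Formalization: The bound on δ_ε is proved for 0<ε≤1/2 rather than 0<ε<1: for ε>1/2 it fails in general (n=1, all non-empty subsets of {0,1}, k=1, ε=15/16). Monotonicity of μ(A,p)/p^k is stated for p in (0,1], as the quotient is undefined at p=0. *)

theory Defs
  imports "HOL-Probability.Probability"
begin

text \<open>Following the source, \<open>[n] = {0, 1, ..., n}\<close>, which has \<open>n + 1\<close> elements.\<close>

definition random_subset :: "nat \<Rightarrow> real \<Rightarrow> nat set pmf" where
  "random_subset n p =
     map_pmf (\<lambda>f. {i \<in> {0..n}. f i}) (Pi_pmf {0..n} False (\<lambda>_. bernoulli_pmf p))"

definition mu :: "nat \<Rightarrow> nat set set \<Rightarrow> real \<Rightarrow> real" where
  "mu n \<A> p = measure_pmf.prob (random_subset n p) \<A>"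

definition monotone_family :: "nat \<Rightarrow> nat set set \<Rightarrow> bool" where
  "monotone_family n \<A> \<longleftrightarrow>
     \<A> \<subseteq> Pow {0..n} \<and> (\<forall>A B. A \<in> \<A> \<longrightarrow> A \<subseteq> B \<longrightarrow> B \<subseteq> {0..n} \<longrightarrow> B \<in> \<A>)"

definition minterms :: "nat set set \<Rightarrow> nat set set" where
  "minterms \<A> = {A \<in> \<A>. \<forall>B \<in> \<A>. B \<subseteq> A \<longrightarrow> B = A}"

definition nontrivial_family :: "nat \<Rightarrow> nat set set \<Rightarrow> bool" where
  "nontrivial_family n \<A> \<longleftrightarrow> \<A> \<noteq> {} \<and> \<A> \<noteq> Pow {0..n}"

text \<open>The definite description below denotes a specific number only when \<open>\<A>\<close> is a
  non-trivial monotone family and \<open>x \<in> [0,1]\<close>: then \<open>mu n \<A>\<close> is continuous and strictly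
  increasing on \<open>[0,1]\<close>, with values \<open>0\<close> and \<open>1\<close> at the endpoints.\<close>

definition crit_prob :: "nat \<Rightarrow> nat set set \<Rightarrow> real \<Rightarrow> real" where
  "crit_prob n \<A> x = (THE p. p \<in> {0..1} \<and> mu n \<A> p = x)"

definition delta :: "nat \<Rightarrow> nat set set \<Rightarrow> real \<Rightarrow> real" where
  "delta n \<A> \<epsilon> = (crit_prob n \<A> (1/2) - crit_prob n \<A> \<epsilon>) / crit_prob n \<A> (1/2)"

end

theory Submission
  imports Defs
begin

text \<open>
  For \<open>p = r q\<close> the random set \<open>[n]\<^sub>p\<close> has the law of \<open>S \<inter> T\<close> with \<open>S\<close>, \<open>T\<close> independent
  copies of \<open>[n]\<^sub>q\<close>, \<open>[n]\<^sub>r\<close>. If \<open>S \<in> \<A>\<close>, pick a minterm \<open>M \<subseteq> S\<close>; with probability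
  \<open>r ^ card M \<ge> r ^ k\<close> the set \<open>T\<close> contains \<open>M\<close>, and then \<open>S \<inter> T \<in> \<A>\<close>. Hence
  \<open>\<mu>(p) \<ge> (p/q)^k \<mu>(q)\<close>. The same coupling shows that \<open>\<mu>\<close> is strictly increasing,
  since \<open>S = [n]\<close>, \<open>T = \<emptyset>\<close> has positive probability when \<open>q > 0\<close> and \<open>r < 1\<close>.
\<close>

section \<open>The law of a random subset and its thinning\<close>

text \<open>The identity holds coordinatewise: a conjunction of independent Bernoulli bits with
  parameters \<open>q\<close> and \<open>p\<close> is a Bernoulli bit with parameter
  \<open>p * q\<close>. \<open>Pi_pmf_bind\<close> lifts this to the product measure.\<close>

lemma random_subset_mult:
  assumes "p \<in> {0..1}" "q \<in> {0..1}"
  shows "random_subset n (p * q) =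
    bind_pmf (random_subset n q) (\<lambda>S. map_pmf (\<lambda>T. S \<inter> T) (random_subset n p))"
proof -
  let ?I = "{0..n}"
  have pq: "0 \<le> p * q" "p * q \<le> 1"
    using assms by (auto intro: mult_le_one)
  have bern: "bernoulli_pmf (p * q) =
      bind_pmf (bernoulli_pmf q) (\<lambda>a. map_pmf (\<lambda>b. a \<and> b) (bernoulli_pmf p))"
  proof (rule pmf_eqI)
    fix b
    have "(\<and>) True = (\<lambda>b. b)" "(\<and>) False = (\<lambda>_. False)"
      by auto
    then have "map_pmf ((\<and>) True) (bernoulli_pmf p) = bernoulli_pmf p"
      and "map_pmf ((\<and>) False) (bernoulli_pmf p) = return_pmf False"
      by (simp_all add: pmf.map_ident map_pmf_const)
    then show "pmf (bernoulli_pmf (p * q)) b =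
      pmf (bind_pmf (bernoulli_pmf q) (\<lambda>a. map_pmf (\<lambda>b. a \<and> b) (bernoulli_pmf p))) b"
      using assms pq by (cases b) (auto simp: pmf_bind algebra_simps)
  qed
  have inner: "Pi_pmf ?I False (\<lambda>x. map_pmf (\<lambda>b. f x \<and> b) (bernoulli_pmf p)) =
      map_pmf (\<lambda>g x. f x \<and> g x) (Pi_pmf ?I False (\<lambda>_. bernoulli_pmf p))" for f :: "nat \<Rightarrow> bool"
  proof -
    have "Pi_pmf ?I False (\<lambda>x. map_pmf (\<lambda>b. f x \<and> b) (bernoulli_pmf p)) =
        bind_pmf (Pi_pmf ?I False (\<lambda>_. bernoulli_pmf p))
          (\<lambda>g. return_pmf (\<lambda>x. if x \<in> ?I then f x \<and> g x else False))"
      unfolding map_pmf_def by (subst Pi_pmf_bind[where d' = False]) auto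
    \<comment> \<open>Every \<open>g\<close> in the support takes the default value
      \<open>False\<close> outside \<open>?I\<close>, so \<open>f x \<and> g x\<close> agrees with
      the else branch there.\<close>
    also have "\<dots> = map_pmf (\<lambda>g x. f x \<and> g x) (Pi_pmf ?I False (\<lambda>_. bernoulli_pmf p))"
      unfolding map_pmf_def
      using set_Pi_pmf_subset[of ?I False "\<lambda>_. bernoulli_pmf p"]
      by (intro bind_pmf_cong arg_cong[where f = return_pmf]) (auto simp: fun_eq_iff)
    finally show ?thesis .
  qed
  have "Pi_pmf ?I False (\<lambda>_. bernoulli_pmf (p * q)) =
      bind_pmf (Pi_pmf ?I False (\<lambda>_. bernoulli_pmf q))
        (\<lambda>f. map_pmf (\<lambda>g x. f x \<and> g x) (Pi_pmf ?I False (\<lambda>_. bernoulli_pmf p)))"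
    unfolding bern by (subst Pi_pmf_bind[where d' = False]) (simp_all add: inner)
  then show ?thesis
    unfolding random_subset_def
    by (simp add: map_bind_pmf bind_map_pmf pmf.map_comp o_def)
       (intro bind_pmf_cong map_pmf_cong refl, auto)
qed

lemma pmf_random_subset:
  assumes "p \<in> {0..1}" "S \<subseteq> {0..n}"
  shows "pmf (random_subset n p) S = p ^ card S * (1 - p) ^ card ({0..n} - S)"
proof -
  let ?P = "Pi_pmf {0..n} False (\<lambda>_. bernoulli_pmf p)"
  have "pmf (random_subset n p) S =
      measure_pmf.prob ?P ((\<lambda>f. {i \<in> {0..n}. f i}) -` {S})"
    unfolding random_subset_def by (simp add: pmf_map)
  \<comment> \<open>Here \<open>{i \<in> S}\<close> is the singleton of a truth value: the event is
    a box that fixes every coordinate, so its probability factorises.\<close>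
  also have "\<dots> = measure_pmf.prob ?P (Pi {0..n} (\<lambda>i. {i \<in> S}))"
    using assms(2) by (intro arg_cong[where f = "measure_pmf.prob ?P"]) (fastforce simp: Pi_def)
  also have "\<dots> = (\<Prod>i\<in>{0..n}. if i \<in> S then p else 1 - p)"
    using assms(1) by (subst measure_Pi_pmf_Pi) (auto intro!: prod.cong simp: measure_pmf_single)
  also have "\<dots> = (\<Prod>i\<in>S. p) * (\<Prod>i\<in>{0..n} - S. 1 - p)"
    using assms(2) by (simp add: prod.If_cases Int_absorb1 Diff_eq)
  finally show ?thesis
    by simp
qed

lemma prob_random_subset_superset:
  assumes "p \<in> {0..1}" "M \<subseteq> {0..n}"
  shows "measure_pmf.prob (random_subset n p) {T. M \<subseteq> T} = p ^ card M"
proof -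
  let ?P = "Pi_pmf {0..n} False (\<lambda>_. bernoulli_pmf p)"
  have "measure_pmf.prob (random_subset n p) {T. M \<subseteq> T} =
      measure_pmf.prob ?P (Pi {0..n} (\<lambda>i. if i \<in> M then {True} else UNIV))"
    using assms(2) unfolding random_subset_def
    by (auto simp: Pi_def subset_iff intro!: arg_cong[where f = "measure_pmf.prob ?P"])
  also have "\<dots> = (\<Prod>i\<in>{0..n}. if i \<in> M then p else 1)"
    using assms(1) by (subst measure_Pi_pmf_Pi) (auto intro!: prod.cong simp: measure_pmf_single)
  also have "\<dots> = p ^ card M"
    using assms(2) by (simp add: prod.If_cases Int_absorb1)
  finally show ?thesis .
qed

lemma set_pmf_random_subset: "set_pmf (random_subset n p) \<subseteq> Pow {0..n}"
  by (auto simp: random_subset_def)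

section \<open>Finite sums for \<open>mu\<close>\<close>

text \<open>Condition on the outer set \<open>S\<close> of the coupling. Both later inequalities for
  \<open>mu\<close> compare this sum term by term with the sum for
  \<open>mu n \<A> q\<close>.\<close>

lemma mu_mult:
  assumes "p \<in> {0..1}" "q \<in> {0..1}"
  shows "mu n \<A> (p * q) = (\<Sum>S\<in>Pow {0..n}. pmf (random_subset n q) S *
    measure_pmf.prob (random_subset n p) {T. S \<inter> T \<in> \<A>})"
proof -
  have "mu n \<A> (p * q) = measure_pmf.expectation (random_subset n q)
      (\<lambda>S. measure_pmf.prob (map_pmf (\<lambda>T. S \<inter> T) (random_subset n p)) \<A>)"
    unfolding mu_def random_subset_mult[OF assms] measure_pmf_bind
    by (subst measure_pmf.measure_bind[where N = "count_space UNIV"])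
       (auto intro: measure_pmf_in_subprob_algebra)
  also have "\<dots> = (\<Sum>S\<in>Pow {0..n}. pmf (random_subset n q) S *
      measure_pmf.prob (map_pmf (\<lambda>T. S \<inter> T) (random_subset n p)) \<A>)"
    using set_pmf_random_subset by (subst integral_measure_pmf[of "Pow {0..n}"]) auto
  also have "\<dots> = (\<Sum>S\<in>Pow {0..n}. pmf (random_subset n q) S *
      measure_pmf.prob (random_subset n p) {T. S \<inter> T \<in> \<A>})"
    by (simp add: vimage_def)
  finally show ?thesis .
qed

lemma mu_eq_sum:
  assumes "\<A> \<subseteq> Pow {0..n}"
  shows "mu n \<A> p = (\<Sum>S\<in>\<A>. pmf (random_subset n p) S)"
  unfolding mu_def using assms by (intro measure_measure_pmf_finite) (auto dest: finite_subset)

lemma mu_polynomial: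
  assumes "\<A> \<subseteq> Pow {0..n}" "p \<in> {0..1}"
  shows "mu n \<A> p = (\<Sum>S\<in>\<A>. p ^ card S * (1 - p) ^ card ({0..n} - S))"
  unfolding mu_eq_sum[OF assms(1)]
  using assms by (intro sum.cong pmf_random_subset) auto

lemma continuous_on_mu:
  assumes "\<A> \<subseteq> Pow {0..n}"
  shows "continuous_on {0..1} (mu n \<A>)"
proof -
  have "continuous_on {0..1} (\<lambda>p::real. \<Sum>S\<in>\<A>. p ^ card S * (1 - p) ^ card ({0..n} - S))"
    by (intro continuous_intros)
  then show ?thesis
    by (rule continuous_on_eq) (simp add: mu_polynomial[OF assms])
qed

section \<open>Minterms and the decreasing ratio\<close>

lemma minterm_below:
  assumes "\<A> \<subseteq> Pow {0..n}" "S \<in> \<A>"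
  obtains M where "M \<in> minterms \<A>" "M \<subseteq> S"
proof -
  have "finite \<A>"
    using assms(1) by (rule finite_subset) simp
  from finite_has_minimal2[OF this assms(2)] show ?thesis
    using that unfolding minterms_def by blast
qed

lemma mu_mult_ge:
  assumes "monotone_family n \<A>" "\<forall>A \<in> minterms \<A>. card A \<le> k"
    and "p \<in> {0..1}" "q \<in> {0..1}"
  shows "p ^ k * mu n \<A> q \<le> mu n \<A> (p * q)"
proof -
  have sub: "\<A> \<subseteq> Pow {0..n}"
    using assms(1) by (simp add: monotone_family_def)
  have inner: "p ^ k \<le> measure_pmf.prob (random_subset n p) {T. S \<inter> T \<in> \<A>}" if "S \<in> \<A>" for S
  proof -
    obtain M where M: "M \<in> minterms \<A>" "M \<subseteq> S"
      using minterm_below[OF sub \<open>S \<in> \<A>\<close>] .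
    have "M \<in> \<A>"
      using M(1) by (simp add: minterms_def)
    \<comment> \<open>The bound on minterm sizes enters here: as \<open>p \<le> 1\<close>, the
      smaller exponent gives the larger power.\<close>
    have "p ^ k \<le> p ^ card M"
      using M(1) assms by (intro power_decreasing) auto
    also have "\<dots> = measure_pmf.prob (random_subset n p) {T. M \<subseteq> T}"
      using \<open>M \<in> \<A>\<close> sub assms(3) by (subst prob_random_subset_superset) auto
    also have "\<dots> \<le> measure_pmf.prob (random_subset n p) {T. S \<inter> T \<in> \<A>}"
    proof (intro measure_pmf.finite_measure_mono subsetI)
      fix T assume "T \<in> {T. M \<subseteq> T}"
      then have "M \<subseteq> S \<inter> T" "S \<inter> T \<subseteq> {0..n}"
        using M(2) sub that by auto
      then show "T \<in> {T. S \<inter> T \<in> \<A>}"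
        using assms(1) \<open>M \<in> \<A>\<close> unfolding monotone_family_def by blast
    qed simp
    finally show ?thesis .
  qed
  have "p ^ k * mu n \<A> q = (\<Sum>S\<in>\<A>. pmf (random_subset n q) S * p ^ k)"
    by (simp add: mu_eq_sum[OF sub] sum_distrib_left mult.commute)
  also have "\<dots> \<le> (\<Sum>S\<in>\<A>. pmf (random_subset n q) S *
      measure_pmf.prob (random_subset n p) {T. S \<inter> T \<in> \<A>})"
    using inner by (intro sum_mono mult_left_mono) auto
  also have "\<dots> \<le> mu n \<A> (p * q)"
    unfolding mu_mult[OF assms(3,4)] using sub by (intro sum_mono2) auto
  finally show ?thesis .
qed

lemma mu_div_power_antimono:
  assumes "monotone_family n \<A>" "\<forall>A \<in> minterms \<A>. card A \<le> k"
  shows "antimono_on {0<..1} (\<lambda>p::real. mu n \<A> p / p ^ k)"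
proof (rule monotone_onI)
  fix p q :: real assume pq: "p \<in> {0<..1}" "q \<in> {0<..1}" "p \<le> q"
  \<comment> \<open>Thinning by the factor \<open>p / q\<close>, at most 1, turns density
    \<open>q\<close> into density \<open>p\<close>.\<close>
  then have "(p / q) ^ k * mu n \<A> q \<le> mu n \<A> (p / q * q)"
    using assms by (intro mu_mult_ge) auto
  then have "p ^ k * mu n \<A> q / q ^ k \<le> mu n \<A> p"
    using pq by (simp add: power_divide)
  then show "mu n \<A> q / q ^ k \<le> mu n \<A> p / p ^ k"
    using pq by (simp add: field_simps)
qed

section \<open>Strict monotonicity and critical probabilities\<close>

lemma nontrivial_family_full_empty:
  assumes "monotone_family n \<A>" "nontrivial_family n \<A>"
  shows "{0..n} \<in> \<A>" "{} \<notin> \<A>"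
  using assms unfolding monotone_family_def nontrivial_family_def by blast+

lemma strict_mono_on_mu:
  assumes "monotone_family n \<A>" "nontrivial_family n \<A>"
  shows "strict_mono_on {0..1} (mu n \<A>)"
proof (rule strict_mono_onI)
  fix p q :: real assume pq: "p \<in> {0..1}" "q \<in> {0..1}" "p < q"
  define r where "r = p / q"
  have r: "0 \<le> r" "r < 1" "p = r * q"
    using pq by (auto simp: r_def)
  have sub: "\<A> \<subseteq> Pow {0..n}"
    using assms(1) by (simp add: monotone_family_def)
  note fe = nontrivial_family_full_empty[OF assms]
  let ?f = "\<lambda>S. measure_pmf.prob (random_subset n r) {T. S \<inter> T \<in> \<A>}"
  \<comment> \<open>By upward closure \<open>S \<inter> T \<in> \<A>\<close> forces
    \<open>S \<in> \<A>\<close>, so both sums run over \<A> only.\<close>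
  have zero: "?f S = 0" if "S \<in> Pow {0..n} - \<A>" for S
  proof -
    have "{T. S \<inter> T \<in> \<A>} = {}"
      using that assms(1) unfolding monotone_family_def by blast
    then show ?thesis
      by simp
  qed
  \<comment> \<open>For \<open>S = {0..n}\<close> the event misses \<open>T = {}\<close>, which has
    probability \<open>(1 - r) ^ (n + 1) > 0\<close>. This term makes the sum inequality
    strict.\<close>
  have full: "?f {0..n} < 1"
  proof -
    have "?f {0..n} \<le> measure_pmf.prob (random_subset n r) (- {{}})"
      using fe(2) by (intro measure_pmf.finite_measure_mono) auto
    also have "\<dots> = 1 - pmf (random_subset n r) {}"
      using measure_pmf.prob_compl[of "{{}}" "random_subset n r"]
      by (simp add: measure_pmf_single Compl_eq_Diff_UNIV)
    also have "\<dots> < 1"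
      using r by (simp add: pmf_random_subset)
    finally show ?thesis .
  qed
  have "mu n \<A> p = (\<Sum>S\<in>\<A>. pmf (random_subset n q) S * ?f S)"
    unfolding r(3) using r pq sub zero
    by (subst mu_mult) (auto intro!: sum.mono_neutral_right)
  also have "\<dots> < (\<Sum>S\<in>\<A>. pmf (random_subset n q) S * 1)"
  proof (rule sum_strict_mono_ex1)
    show "finite \<A>"
      using sub by (rule finite_subset) simp
    show "\<forall>S\<in>\<A>. pmf (random_subset n q) S * ?f S \<le> pmf (random_subset n q) S * 1"
      by (intro ballI mult_left_mono) auto
    have "0 < pmf (random_subset n q) {0..n}"
      using pq by (simp add: pmf_random_subset)
    then show "\<exists>S\<in>\<A>. pmf (random_subset n q) S * ?f S < pmf (random_subset n q) S * 1"
      using fe(1) full by (intro bexI[of _ "{0..n}"] mult_strict_left_mono)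
  qed
  also have "\<dots> = mu n \<A> q"
    by (simp add: mu_eq_sum[OF sub])
  finally show "mu n \<A> p < mu n \<A> q" .
qed

lemma mu_endpoints:
  assumes "monotone_family n \<A>" "nontrivial_family n \<A>"
  shows "mu n \<A> 0 = 0" "mu n \<A> 1 = 1"
proof -
  have sub: "\<A> \<subseteq> Pow {0..n}"
    using assms(1) by (simp add: monotone_family_def)
  have fin: "finite \<A>"
    using sub by (rule finite_subset) simp
  note fe = nontrivial_family_full_empty[OF assms]
  have "card S \<noteq> 0" if "S \<in> \<A>" for S
  proof -
    have "finite S" "S \<noteq> {}"
      using that fe(2) sub by (auto intro: finite_subset)
    then show ?thesis
      by simp
  qed
  then show "mu n \<A> 0 = 0"
    using mu_polynomial[OF sub, of 0] by (auto simp: power_0_left intro!: sum.neutral)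
  \<comment> \<open>The factor \<open>0 ^ card ({0..n} - S)\<close> vanishes unless the complement
    is empty, where \<open>0 ^ 0 = 1\<close>.\<close>
  have "mu n \<A> 1 = (\<Sum>S\<in>\<A>. if S = {0..n} then 1 else 0)"
    using sub by (subst mu_polynomial) (auto intro!: sum.cong simp: power_0_left)
  then show "mu n \<A> 1 = 1"
    using fe(1) fin by simp
qed

text \<open>The intermediate value theorem gives existence and strict monotonicity gives uniqueness,
  so the definite description in \<open>crit_prob\<close> denotes.\<close>

lemma crit_prob_works:
  assumes "monotone_family n \<A>" "nontrivial_family n \<A>" "x \<in> {0..1}"
  shows "crit_prob n \<A> x \<in> {0..1}" "mu n \<A> (crit_prob n \<A> x) = x"
proof -
  have sub: "\<A> \<subseteq> Pow {0..n}"
    using assms(1) by (simp add: monotone_family_def)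
  obtain p where p: "p \<in> {0..1}" "mu n \<A> p = x"
    using IVT'[of "mu n \<A>" 0 x 1] mu_endpoints[OF assms(1,2)] continuous_on_mu[OF sub] assms(3)
    by auto
  have "\<exists>!p. p \<in> {0..1} \<and> mu n \<A> p = x"
    using p strict_mono_on_imp_inj_on[OF strict_mono_on_mu[OF assms(1,2)]]
    by (metis inj_onD)
  from theI'[OF this] show "crit_prob n \<A> x \<in> {0..1}" "mu n \<A> (crit_prob n \<A> x) = x"
    by (auto simp: crit_prob_def)
qed

theorem theorem2p1:
  fixes n k :: nat and \<A> :: "nat set set"
  assumes "k \<ge> 1"
    and "monotone_family n \<A>"
    and "\<forall>A \<in> minterms \<A>. card A \<le> k"
  shows "antimono_on {0<..1} (\<lambda>p::real. mu n \<A> p / p ^ k) \<and>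
    (nontrivial_family n \<A> \<longrightarrow>
      (\<forall>\<epsilon>::real. 0 < \<epsilon> \<and> \<epsilon> \<le> 1/2 \<longrightarrow>
        delta n \<A> \<epsilon> \<ge> 1 - (2 * \<epsilon>) powr (1 / real k)))"
proof (intro conjI impI allI)
  show anti: "antimono_on {0<..1} (\<lambda>p::real. mu n \<A> p / p ^ k)"
    using assms(2,3) by (rule mu_div_power_antimono)
  fix \<epsilon> :: real
  assume nt: "nontrivial_family n \<A>" and eps: "0 < \<epsilon> \<and> \<epsilon> \<le> 1/2"
  define a where "a = crit_prob n \<A> \<epsilon>"
  define b where "b = crit_prob n \<A> (1/2)"
  have a: "a \<in> {0..1}" "mu n \<A> a = \<epsilon>"
    unfolding a_def using crit_prob_works[OF assms(2) nt, of \<epsilon>] eps by auto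
  have b: "b \<in> {0..1}" "mu n \<A> b = 1/2"
    unfolding b_def using crit_prob_works[OF assms(2) nt, of "1/2"] by auto
  \<comment> \<open>\<open>mu\<close> vanishes at 0 but is positive at \<open>a\<close> and
    \<open>b\<close>; the ratio is known to decrease only on \<open>{0<..1}\<close>.\<close>
  have "a \<noteq> 0" "b \<noteq> 0"
    using a b eps mu_endpoints(1)[OF assms(2) nt] by auto
  then have pos: "0 < a" "0 < b"
    using a b by auto
  \<comment> \<open>This uses \<epsilon> \<le> 1/2. For 1/2 < \<epsilon> < 1 the order of
    \<open>a\<close> and \<open>b\<close> is reversed, and the same argument bounds
    \<open>delta\<close> from above instead.\<close>
  have "a \<le> b"
    using strict_mono_onD[OF strict_mono_on_mu[OF assms(2) nt] b(1) a(1)] a(2) b(2) eps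
    by (cases "b < a") auto
  then have "(1/2) / b ^ k \<le> \<epsilon> / a ^ k"
    using monotone_onD[OF anti, of a b] a b pos by simp
  then have "(a / b) ^ k \<le> 2 * \<epsilon>"
    using pos by (simp add: field_simps)
  then have "((a / b) ^ k) powr (1 / real k) \<le> (2 * \<epsilon>) powr (1 / real k)"
    using pos by (intro powr_mono2) auto
  moreover have "((a / b) ^ k) powr (1 / real k) = a / b"
    using pos assms(1) by (simp add: powr_powr flip: powr_realpow)
  moreover have "delta n \<A> \<epsilon> = 1 - a / b"
    using pos by (simp add: delta_def a_def b_def diff_divide_distrib)
  ultimately show "delta n \<A> \<epsilon> \<ge> 1 - (2 * \<epsilon>) powr (1 / real k)"
    by simp
qed

end
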